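(* Let $X\in\mathbb{R}^{m\times n}$, $b=X\ddot\beta+\varepsilon\in\mathbb{R}^m$ with $\varepsilon\neq0$, $\lambda>0$, let $p$ be a norm on $\mathbb{R}^n$ with strongly semismooth proximal mapping, let $q:\mathbb{R}^n\to\mathbb{R}$ be convex and continuously differentiable, and let $g(\beta):=\|X\beta-b\|+\lambda p(\beta)-q(\beta)$. Suppose that $g$ is bounded below and that the non-overfitting assumption (N) given in the context holds. Assume that $\{\sigma^{2,k}\}$ and $\{\tau^{2,k}\}$ are convergent sequences. Let $\{\beta^k\}$ be the (infinite) sequence generated by the PMM algorithm described in the context. Then every cluster point of the sequence $\{\beta^k\}$, if one exists, is a d-stationary point of the problem $\min_{\beta\in\mathbb{R}^n}g(\beta)$.
   Context: $\|\cdot\|$ is the Euclidean norm; $\mathrm{Prox}_f(x):=\arg\min_y\{f(y)+\frac12\|y-x\|^2\}$. A map is strongly semismooth if it is locally Lipschitz, directionally differentiable, and $F(v+\Delta v)-F(v)-\Gamma\Delta v=O(\|\Delta v\|^2)$ for all $\Gamma$ in its Clarke generalized Jacobian at $v+\Delta v$, $\Delta v\to0$, at every $v$. A point $\bar\beta$ is d-stationary for $g$ if $g'(\bar\beta;d):=\lim_{t\downarrow0}\frac{g(\bar\beta+td)-g(\bar\beta)}{t}\ge0$ for all $d\in\mathbb{R}^n$. For $\sigma,\tau>0$, $\tilde\beta,\tilde v\in\mathbb{R}^n$, $\tilde b\in\mathbb{R}^m$ let $$h(\beta;\sigma,\tau,\tilde\beta,\tilde v,\tilde b):=\|X\beta-b\|+\lambda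 p(\beta)-q(\tilde\beta)-\langle\tilde v,\beta-\tilde\beta\rangle+\frac{\sigma}{2}\|\beta-\tilde\beta\|^2+\frac{\tau}{2}\|X\beta-\tilde b\|^2.$$ PMM algorithm. Let $\sigma^{2,0}>0,\tau^{2,0}>0$. Step 1: for some $\sigma^1,\tau^1>0$ compute an approximate minimizer $\beta^0=\mathrm{Prox}_{\lambda p/\sigma^1}(-X^Tu^0/\sigma^1)$ of $h(\cdot;\sigma^1,\tau^1,0,0,b)$, where $u^0\in\mathbb{R}^m$ is an approximate solution of its dual, up to a prescribed stopping criterion on the KKT residual of $\min_\beta\{\|X\beta-b\|+\lambda p(\beta)\}$. Step 2.1: for $k=0,1,\dots$, with $h_k(\beta):=h(\beta;\sigma^{2,k},\tau^{2,k},\beta^k,\nabla q(\beta^k),X\beta^k)$, compute $$\beta^{k+1}=\arg\min_{\beta\in\mathbb{R}^n}\{h_k(\beta)+\langle\delta^k,\beta-\beta^k\rangle\},$$ obtained as $\beta^{k+1}=\mathrm{Prox}_{\lambda p/\sigma^{2,k}}\big(\beta^k+(\nabla q(\beta^k)-X^Tu^{k+1})/\sigma^{2,k}\big)$ from an approximate dual solution $u^{k+1}\in\mathbb{R}^m$, such that the error vector $\delta^k\in\mathbb{R}^n$ satisfies $$\|\delta^k\|\le\frac{\sigma^{2,k}}{4}\|\beta^{k+1}-\beta^k\|+\frac{\tau^{2,k}\|X\beta^{k+1}-X\beta^k\|^2}{2\|\beta^{k+1}-\beta^k\|}$$ (the fraction is read as $0$ if $\beta^{k+1}=\beta^k$).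 Step 2.2: set $\sigma^{2,k+1}=\rho_k\sigma^{2,k}$, $\tau^{2,k+1}=\rho_k\tau^{2,k}$ with $\rho_k\in(0,1)$, and repeat Step 2.1 with $k+1$. Non-overfitting assumption (N): with $\sigma=\sigma^1,\tau=\tau^1$, the minimizer $\hat\beta$ of $\|X\beta-b\|+\lambda p(\beta)+\frac{\sigma}{2}\|\beta\|^2+\frac{\tau}{2}\|X\beta-b\|^2$ satisfies $\|b-X\hat\beta\|\neq0$, and $a+\frac{2\lambda_0n_p}{\lambda}<1$, where $p_*(\beta)=\max\{\langle z,\beta\rangle:p(z)\le1\}$, $n_p=\frac{\lambda p(\ddot\beta)}{\|\varepsilon\|}$, $\lambda_0=\frac{p_*(X^T\varepsilon)}{\|\varepsilon\|}$, $t_1=1+\frac{\tau}{2}\|\varepsilon\|+\frac{\sigma p_*(\ddot\beta)p(\ddot\beta)}{2\|\varepsilon\|}$, $c_u=t_1+n_p$, $a=(\lambda_0+\sigma p_*(\ddot\beta)c_u)\frac{t_1}{\lambda}$. *)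

theory Defs
  imports "HOL-Analysis.Analysis"
begin

definition is_norm :: "('a::real_vector \<Rightarrow> real) \<Rightarrow> bool" where
  "is_norm p \<longleftrightarrow>
     (\<forall>x. p x \<ge> 0) \<and> (\<forall>x. p x = 0 \<longleftrightarrow> x = 0) \<and>
     (\<forall>c x. p (c *\<^sub>R x) = \<bar>c\<bar> * p x) \<and> (\<forall>x y. p (x + y) \<le> p x + p y)"

text \<open>For a norm \<open>p\<close> on a Euclidean space the set is compact and nonempty, so the
  supremum is the maximum \<open>max {\<langle>z, x\<rangle> : p z \<le> 1}\<close>.\<close>
definition dual_norm :: "('a::euclidean_space \<Rightarrow> real) \<Rightarrow> 'a \<Rightarrow> real" where
  "dual_norm p x = Sup {z \<bullet> x | z. p z \<le> 1}"

definition prox :: "('a::euclidean_space \<Rightarrow> real) \<Rightarrow> 'a \<Rightarrow> 'a" where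
  "prox f x = arg_min (\<lambda>y. f y + 1 / 2 * (norm (y - x))\<^sup>2) (\<lambda>_. True)"

definition locally_lipschitz :: "('a::euclidean_space \<Rightarrow> 'b::euclidean_space) \<Rightarrow> bool" where
  "locally_lipschitz F \<longleftrightarrow> (\<forall>v. \<exists>e>0. \<exists>L. lipschitz_on L (ball v e) F)"

definition has_dir_deriv ::
    "('a::real_normed_vector \<Rightarrow> 'b::real_normed_vector) \<Rightarrow> 'a \<Rightarrow> 'a \<Rightarrow> 'b \<Rightarrow> bool" where
  "has_dir_deriv F v d l \<longleftrightarrow>
     ((\<lambda>t. (F (v + t *\<^sub>R d) - F v) /\<^sub>R t) \<longlongrightarrow> l) (at_right (0::real))"

text \<open>Clarke's generalized Jacobian: the convex hull of all limits of Jacobians at points of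
  differentiability converging to \<open>v\<close>. Jacobians are represented as bounded linear maps.\<close>
definition clarke_jacobian ::
    "('a::euclidean_space \<Rightarrow> 'b::euclidean_space) \<Rightarrow> 'a \<Rightarrow> ('a \<Rightarrow>\<^sub>L 'b) set" where
  "clarke_jacobian F v = convex hull
     {J. \<exists>x Js. x \<longlonglongrightarrow> v \<and> (\<forall>k. (F has_derivative blinfun_apply (Js k)) (at (x k))) \<and> Js \<longlonglongrightarrow> J}"

definition strongly_semismooth :: "('a::euclidean_space \<Rightarrow> 'b::euclidean_space) \<Rightarrow> bool" where
  "strongly_semismooth F \<longleftrightarrow>
     locally_lipschitz F \<and>
     (\<forall>v d. \<exists>l. has_dir_deriv F v d l) \<and>
     (\<forall>v. \<exists>C. \<exists>r>0. \<forall>dv. norm dv < r \<longrightarrow>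
        (\<forall>\<Gamma> \<in> clarke_jacobian F (v + dv).
           norm (F (v + dv) - F v - blinfun_apply \<Gamma> dv) \<le> C * (norm dv)\<^sup>2))"

text \<open>The limit defining the directional derivative is required to exist.\<close>
definition d_stationary :: "('a::euclidean_space \<Rightarrow> real) \<Rightarrow> 'a \<Rightarrow> bool" where
  "d_stationary g x \<longleftrightarrow> (\<forall>d. \<exists>l. has_dir_deriv g x d l \<and> l \<ge> 0)"

definition cluster_point :: "(nat \<Rightarrow> 'a::topological_space) \<Rightarrow> 'a \<Rightarrow> bool" where
  "cluster_point s x \<longleftrightarrow> (\<exists>r. strict_mono (r :: nat \<Rightarrow> nat) \<and> (s \<circ> r) \<longlonglongrightarrow> x)"

definition g_obj ::
    "real^'n^'m \<Rightarrow> real^'m \<Rightarrow> real \<Rightarrow> (real^'n \<Rightarrow> real) \<Rightarrow> (real^'n \<Rightarrow> real) \<Rightarrow> real^'n \<Rightarrow> real" where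
  "g_obj X b lam p q \<beta> = norm (X *v \<beta> - b) + lam * p \<beta> - q \<beta>"

definition h_obj ::
    "real^'n^'m \<Rightarrow> real^'m \<Rightarrow> real \<Rightarrow> (real^'n \<Rightarrow> real) \<Rightarrow> (real^'n \<Rightarrow> real) \<Rightarrow>
     real^'n \<Rightarrow> real \<Rightarrow> real \<Rightarrow> real^'n \<Rightarrow> real^'n \<Rightarrow> real^'m \<Rightarrow> real" where
  "h_obj X b lam p q \<beta> \<sigma> \<tau> \<beta>' v' b' =
     norm (X *v \<beta> - b) + lam * p \<beta> - q \<beta>' - v' \<bullet> (\<beta> - \<beta>')
     + \<sigma> / 2 * (norm (\<beta> - \<beta>'))\<^sup>2 + \<tau> / 2 * (norm (X *v \<beta> - b'))\<^sup>2"

text \<open>The KKT system of \<open>min \<parallel>X \<beta> - b\<parallel> + \<lambda> p \<beta>\<close> with multiplier \<open>u\<close>, namely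
  \<open>- X\<^sup>T u \<in> \<lambda> \<partial>p \<beta>\<close> and \<open>u \<in> \<partial>\<parallel>\<cdot>\<parallel> (X \<beta> - b)\<close>, holds iff both components vanish.\<close>
definition kkt_residual ::
    "real^'n^'m \<Rightarrow> real^'m \<Rightarrow> real \<Rightarrow> (real^'n \<Rightarrow> real) \<Rightarrow> real^'n \<Rightarrow> real^'m \<Rightarrow> (real^'n) \<times> (real^'m)" where
  "kkt_residual X b lam p \<beta> u =
     (\<beta> - prox (\<lambda>y. lam * p y) (\<beta> - transpose X *v u),
      (X *v \<beta> - b) - prox norm ((X *v \<beta> - b) + u))"

text \<open>\<open>crit \<beta> u r\<close> is the prescribed stopping test of Step 1 on the KKT residual \<open>r\<close>; it also
  sees \<open>\<beta>\<close> and \<open>u\<close> so that relative (normalised) residuals are covered.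
  It is the only accuracy requirement on the pair \<open>(\<beta> 0, u 0)\<close>.\<close>
definition pmm_step1 ::
    "real^'n^'m \<Rightarrow> real^'m \<Rightarrow> real \<Rightarrow> (real^'n \<Rightarrow> real) \<Rightarrow>
     (real^'n \<Rightarrow> real^'m \<Rightarrow> (real^'n) \<times> (real^'m) \<Rightarrow> bool) \<Rightarrow>
     real \<Rightarrow> real \<Rightarrow> real^'n \<Rightarrow> real^'m \<Rightarrow> bool" where
  "pmm_step1 X b lam p crit \<sigma>1 \<tau>1 \<beta>0 u0 \<longleftrightarrow>
     \<sigma>1 > 0 \<and> \<tau>1 > 0 \<and>
     \<beta>0 = prox (\<lambda>y. lam * p y / \<sigma>1) (- (transpose X *v u0) /\<^sub>R \<sigma>1) \<and>
     crit \<beta>0 u0 (kkt_residual X b lam p \<beta>0 u0)"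

text \<open>Step 2.1; \<open>gq\<close> is the gradient of \<open>q\<close>, and \<open>\<beta>, \<beta>', u', \<delta>\<close> stand for
  \<open>\<beta>\<^sup>k, \<beta>\<^sup>k\<^sup>+\<^sup>1, u\<^sup>k\<^sup>+\<^sup>1, \<delta>\<^sup>k\<close>. The fraction in the error bound is \<open>0\<close> when \<open>\<beta>' = \<beta>\<close>, by the
  convention \<open>x / 0 = 0\<close>.\<close>
definition pmm_step2 ::
    "real^'n^'m \<Rightarrow> real^'m \<Rightarrow> real \<Rightarrow> (real^'n \<Rightarrow> real) \<Rightarrow> (real^'n \<Rightarrow> real) \<Rightarrow> (real^'n \<Rightarrow> real^'n) \<Rightarrow>
     real \<Rightarrow> real \<Rightarrow> real^'n \<Rightarrow> real^'n \<Rightarrow> real^'m \<Rightarrow> real^'n \<Rightarrow> bool" where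
  "pmm_step2 X b lam p q gq \<sigma> \<tau> \<beta> \<beta>' u' \<delta> \<longleftrightarrow>
     is_arg_min (\<lambda>z. h_obj X b lam p q z \<sigma> \<tau> \<beta> (gq \<beta>) (X *v \<beta>) + \<delta> \<bullet> (z - \<beta>)) (\<lambda>_. True) \<beta>' \<and>
     \<beta>' = prox (\<lambda>y. lam * p y / \<sigma>) (\<beta> + (gq \<beta> - transpose X *v u') /\<^sub>R \<sigma>) \<and>
     norm \<delta> \<le> \<sigma> / 4 * norm (\<beta>' - \<beta>)
               + \<tau> * (norm (X *v \<beta>' - X *v \<beta>))\<^sup>2 / (2 * norm (\<beta>' - \<beta>))"

definition pmm_sequence ::
    "real^'n^'m \<Rightarrow> real^'m \<Rightarrow> real \<Rightarrow> (real^'n \<Rightarrow> real) \<Rightarrow> (real^'n \<Rightarrow> real) \<Rightarrow> (real^'n \<Rightarrow> real^'n) \<Rightarrow>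
     (real^'n \<Rightarrow> real^'m \<Rightarrow> (real^'n) \<times> (real^'m) \<Rightarrow> bool) \<Rightarrow>
     real \<Rightarrow> real \<Rightarrow> (nat \<Rightarrow> real) \<Rightarrow> (nat \<Rightarrow> real) \<Rightarrow> (nat \<Rightarrow> real) \<Rightarrow>
     (nat \<Rightarrow> real^'n) \<Rightarrow> (nat \<Rightarrow> real^'m) \<Rightarrow> (nat \<Rightarrow> real^'n) \<Rightarrow> bool" where
  "pmm_sequence X b lam p q gq crit \<sigma>1 \<tau>1 \<sigma>2 \<tau>2 \<rho> \<beta> u \<delta> \<longleftrightarrow>
     \<sigma>2 0 > 0 \<and> \<tau>2 0 > 0 \<and>
     pmm_step1 X b lam p crit \<sigma>1 \<tau>1 (\<beta> 0) (u 0) \<and>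
     (\<forall>k. pmm_step2 X b lam p q gq (\<sigma>2 k) (\<tau>2 k) (\<beta> k) (\<beta> (Suc k)) (u (Suc k)) (\<delta> k)) \<and>
     (\<forall>k. 0 < \<rho> k \<and> \<rho> k < 1 \<and> \<sigma>2 (Suc k) = \<rho> k * \<sigma>2 k \<and> \<tau>2 (Suc k) = \<rho> k * \<tau>2 k)"

text \<open>\<open>b\<close> is the response \<open>X \<beta>t + \<epsilon>\<close>, with \<open>\<beta>t\<close> the true coefficient vector and
  \<open>\<epsilon>\<close> the noise. The minimizer is unique because \<open>\<sigma> > 0\<close> makes the objective strongly convex.\<close>
definition non_overfitting ::
    "real^'n^'m \<Rightarrow> real^'m \<Rightarrow> real \<Rightarrow> (real^'n \<Rightarrow> real) \<Rightarrow> real^'n \<Rightarrow> real^'m \<Rightarrow> real \<Rightarrow> real \<Rightarrow> bool" where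
  "non_overfitting X b lam p \<beta>t \<epsilon> \<sigma> \<tau> \<longleftrightarrow>
     (let \<beta>h = arg_min (\<lambda>\<beta>. norm (X *v \<beta> - b) + lam * p \<beta> + \<sigma> / 2 * (norm \<beta>)\<^sup>2
                              + \<tau> / 2 * (norm (X *v \<beta> - b))\<^sup>2) (\<lambda>_. True);
          np = lam * p \<beta>t / norm \<epsilon>;
          lam0 = dual_norm p (transpose X *v \<epsilon>) / norm \<epsilon>;
          t1 = 1 + \<tau> / 2 * norm \<epsilon> + \<sigma> * dual_norm p \<beta>t * p \<beta>t / (2 * norm \<epsilon>);
          cu = t1 + np;
          a = (lam0 + \<sigma> * dual_norm p \<beta>t * cu) * (t1 / lam)
      in norm (b - X *v \<beta>h) \<noteq> 0 \<and> a + 2 * lam0 * np / lam < 1)"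

end

theory Submission
  imports Defs
begin

text \<open>
  Write \<open>f \<beta> = \<parallel>X \<beta> - b\<parallel> + \<lambda> p \<beta>\<close>, so that \<open>g = f - q\<close> with \<open>f\<close> and \<open>q\<close> convex. The model \<open>h\<^sub>k\<close>
  replaces \<open>q\<close> by its linearization at \<open>\<beta>\<^sup>k\<close> and adds proximal terms; by convexity of \<open>q\<close> it
  lies above \<open>g\<close> plus those terms and agrees with \<open>g\<close> at \<open>\<beta>\<^sup>k\<close>. The accuracy demanded of
  \<open>\<delta>\<^sup>k\<close> is such that the error costs at most half of the \<open>\<sigma>\<close>-term and all of the \<open>\<tau>\<close>-term. Hence the
  values \<open>g \<beta>\<^sup>k\<close> decrease, and \<open>\<sigma>\<^sup>k \<parallel>\<beta>\<^sup>k\<^sup>+\<^sup>1 - \<beta>\<^sup>k\<parallel>\<^sup>2 \<longlonglongrightarrow> 0\<close> since \<open>g\<close> is bounded below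
  (\<open>pmm_step2_sufficient_decrease\<close>).

  The limit \<open>\<sigma>\<close> of \<open>\<sigma>\<^sup>k\<close> may be \<open>0\<close>, in which case this does not force the steps
  \<open>\<beta>\<^sup>k\<^sup>+\<^sup>1 - \<beta>\<^sup>k\<close> to vanish, and one cannot simply pass to the limit in the optimality
  condition at \<open>\<beta>\<^sup>k\<^sup>+\<^sup>1\<close>. Two observations avoid this. Both parameters are scaled by the same
  factor, so \<open>\<tau>\<^sup>k / \<sigma>\<^sup>k\<close> is constant, and the error is at most a constant times
  \<open>\<sigma>\<^sup>k \<parallel>\<beta>\<^sup>k\<^sup>+\<^sup>1 - \<beta>\<^sup>k\<parallel>\<close> (\<open>pmm_step2_error_bound\<close>); this tends to \<open>0\<close>, because its square is
  \<open>\<sigma>\<^sup>k\<close> times a null sequence. And the optimality of \<open>\<beta>\<^sup>k\<^sup>+\<^sup>1\<close> can be used through values alone: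
  for every \<open>z\<close>,
  \<open>g \<beta>\<^sup>k\<^sup>+\<^sup>1 \<le> h\<^sub>k z + \<langle>\<delta>\<^sup>k, z - \<beta>\<^sup>k\<rangle>\<close>.
  Along a subsequence with \<open>\<beta>\<^sup>k \<longlonglongrightarrow> x\<close> the left side tends to \<open>g x\<close>, because the whole sequence of
  values is monotone, wherever the points \<open>\<beta>\<^sup>k\<^sup>+\<^sup>1\<close> themselves go. So \<open>x\<close> minimizes the limit model
  \<open>f z - q x - \<langle>\<nabla>q x, z - x\<rangle> + \<sigma>/2 \<parallel>z - x\<parallel>\<^sup>2 + \<tau>/2 \<parallel>X z - X x\<parallel>\<^sup>2\<close>. The quadratic terms are of
  second order at \<open>x\<close>, so \<open>f'(x; d) \<ge> \<langle>\<nabla>q x, d\<rangle>\<close> for all \<open>d\<close>, that is, \<open>g'(x; d) \<ge> 0\<close>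
  (\<open>d_stationary_of_quadratic_majorant\<close>).
\<close>

section \<open>Convexity and directional derivatives\<close>

lemma is_norm_imp_convex_on:
  assumes "is_norm p"
  shows "convex_on UNIV p"
proof (rule convex_onI)
  fix t :: real and x y
  assume t: "0 < t" "t < 1"
  have "p ((1 - t) *\<^sub>R x + t *\<^sub>R y) \<le> p ((1 - t) *\<^sub>R x) + p (t *\<^sub>R y)"
    using assms unfolding is_norm_def by blast
  also have "\<dots> = (1 - t) * p x + t * p y"
    using assms t by (simp add: is_norm_def)
  finally show "p ((1 - t) *\<^sub>R x + t *\<^sub>R y) \<le> (1 - t) * p x + t * p y" .
qed simp

lemma convex_on_line:
  fixes f :: "'a::real_vector \<Rightarrow> real"
  assumes "convex_on UNIV f"
  shows "convex_on UNIV (\<lambda>t. f (x + t *\<^sub>R d))"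
proof (rule convex_onI)
  fix t r s :: real
  assume t: "0 < t" "t < 1"
  have "x + ((1 - t) *\<^sub>R r + t *\<^sub>R s) *\<^sub>R d
      = (1 - t) *\<^sub>R (x + r *\<^sub>R d) + t *\<^sub>R (x + s *\<^sub>R d)"
    by (simp add: algebra_simps)
  then show "f (x + ((1 - t) *\<^sub>R r + t *\<^sub>R s) *\<^sub>R d)
      \<le> (1 - t) * f (x + r *\<^sub>R d) + t * f (x + s *\<^sub>R d)"
    using convex_onD[OF assms, of t "x + r *\<^sub>R d" "x + s *\<^sub>R d"] t by simp
qed simp

lemma GDERIV_line:
  assumes "GDERIV q x :> v"
  shows "((\<lambda>t. q (x + t *\<^sub>R d)) has_real_derivative v \<bullet> d) (at 0)"
proof -
  have "(q has_derivative (\<lambda>h. h \<bullet> v)) (at (x + 0 *\<^sub>R d))"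
    using assms by (simp add: gderiv_def)
  then have "((\<lambda>t. q (x + t *\<^sub>R d)) has_derivative (\<lambda>s. (s *\<^sub>R d) \<bullet> v)) (at 0)"
    by (rule has_derivative_compose[rotated]) (auto intro!: derivative_eq_intros)
  moreover have "(\<lambda>s. (s *\<^sub>R d) \<bullet> v) = (*) (v \<bullet> d)"
    by (simp add: fun_eq_iff inner_commute)
  ultimately show ?thesis
    by (simp add: has_field_derivative_def)
qed

lemma convex_on_above_gradient:
  assumes "convex_on UNIV q" and "GDERIV q x :> v"
  shows "q x + v \<bullet> (z - x) \<le> q z"
  using convex_on_imp_above_tangent
      [OF convex_on_line[OF assms(1), of x "z - x"] connected_UNIV _ _ 
        GDERIV_line[OF assms(2), of "z - x"], of 1]
  by simp

lemma GDERIV_imp_has_dir_deriv: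
  assumes "GDERIV q x :> v"
  shows "has_dir_deriv q x d (v \<bullet> d)"
proof -
  have "((\<lambda>t. (q (x + t *\<^sub>R d) - q x) /\<^sub>R t) \<longlongrightarrow> v \<bullet> d) (at 0)"
    using GDERIV_line[OF assms, of d] by (simp add: DERIV_def divide_inverse mult.commute)
  then show ?thesis
    unfolding has_dir_deriv_def by (rule tendsto_within_subset[OF _ subset_UNIV])
qed

lemma has_dir_deriv_diff:
  assumes "has_dir_deriv f x d l" and "has_dir_deriv q x d k"
  shows "has_dir_deriv (\<lambda>y. f y - q y) x d (l - k)"
  using tendsto_diff[OF assms[unfolded has_dir_deriv_def]]
  by (simp add: has_dir_deriv_def algebra_simps)

text \<open>The difference quotient of a convex function along a ray is nondecreasing in the step
  \<open>t > 0\<close>, and it is bounded below by the slope over \<open>[-1, 0]\<close>, so it converges to its infimum as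
  \<open>t\<close> decreases to \<open>0\<close>.\<close>
lemma convex_on_has_dir_deriv:
  fixes f :: "'a::real_normed_vector \<Rightarrow> real"
  assumes "convex_on UNIV f"
  shows "\<exists>l. has_dir_deriv f x d l"
proof -
  define \<phi> where "\<phi> t = f (x + t *\<^sub>R d)" for t :: real
  have cv: "convex_on UNIV \<phi>"
    unfolding \<phi>_def by (rule convex_on_line[OF assms])
  define s where "s t = (\<phi> t - \<phi> 0) / t" for t :: real
  have mono: "s a \<le> s b" if "0 < a" "a \<le> b" for a b
  proof -
    have "\<phi> ((1 - a / b) *\<^sub>R 0 + (a / b) *\<^sub>R b) \<le> (1 - a / b) * \<phi> 0 + (a / b) * \<phi> b"
      using that by (intro convex_onD[OF cv]) auto
    then have "\<phi> a - \<phi> 0 \<le> (a / b) * (\<phi> b - \<phi> 0)"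
      using that by (simp add: algebra_simps)
    then show ?thesis
      using that by (simp add: s_def field_simps)
  qed
  have bound: "\<phi> 0 - \<phi> (- 1) \<le> s t" if "0 < t" for t
  proof -
    have "\<phi> ((1 - 1 / (1 + t)) *\<^sub>R (- 1) + (1 / (1 + t)) *\<^sub>R t)
        \<le> (1 - 1 / (1 + t)) * \<phi> (- 1) + (1 / (1 + t)) * \<phi> t"
      using that by (intro convex_onD[OF cv]) auto
    moreover have "(1 - 1 / (1 + t)) *\<^sub>R (- 1) + (1 / (1 + t)) *\<^sub>R t = 0"
      using that by (simp add: field_simps)
    moreover have "(1 - 1 / (1 + t)) * \<phi> (- 1) + (1 / (1 + t)) * \<phi> t
        = (t * \<phi> (- 1) + \<phi> t) / (1 + t)"
    proof -
      have "1 - 1 / (1 + t) = t / (1 + t)"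
        using that by (simp add: field_simps)
      then show ?thesis
        by (simp add: add_divide_distrib)
    qed
    ultimately have "\<phi> 0 \<le> (t * \<phi> (- 1) + \<phi> t) / (1 + t)"
      by simp
    then show ?thesis
      using that by (simp add: s_def field_simps)
  qed
  have "(s \<longlongrightarrow> Inf (s ` ({0<..} \<inter> UNIV))) (at 0 within ({0<..} \<inter> UNIV))"
    by (rule Lim_right_bound) (use mono bound in auto)
  then have "has_dir_deriv f x d (Inf (s ` {0<..}))"
    by (simp add: has_dir_deriv_def s_def[abs_def] \<phi>_def divide_inverse mult.commute)
  then show ?thesis ..
qed

text \<open>The hypothesis compares \<open>f - q\<close> at \<open>x\<close> with a model in which \<open>q\<close> is linearized and a quadratic is
  added. Along \<open>x + t d\<close> the quadratic contributes \<open>O(t)\<close> to the difference quotient, so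
  in the limit only \<open>f'(x; d) - \<langle>v, d\<rangle>\<close>, the directional derivative of \<open>f - q\<close>, survives.\<close>
lemma d_stationary_of_quadratic_majorant:
  fixes f q :: "'a::euclidean_space \<Rightarrow> real"
  assumes "convex_on UNIV f" and "GDERIV q x :> v"
    and min: "\<And>z. f x \<le> f z - v \<bullet> (z - x) + K * (norm (z - x))\<^sup>2"
  shows "d_stationary (\<lambda>z. f z - q z) x"
  unfolding d_stationary_def
proof
  fix d
  obtain l where l: "has_dir_deriv f x d l"
    using convex_on_has_dir_deriv[OF assms(1)] by blast
  have "((\<lambda>t. (f (x + t *\<^sub>R d) - f x) /\<^sub>R t - v \<bullet> d + t * (K * (norm d)\<^sup>2))
      \<longlongrightarrow> l - v \<bullet> d + 0 * (K * (norm d)\<^sup>2)) (at_right 0)"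
    by (intro tendsto_intros l[unfolded has_dir_deriv_def])
  moreover have "\<forall>\<^sub>F t in at_right 0.
      0 \<le> (f (x + t *\<^sub>R d) - f x) /\<^sub>R t - v \<bullet> d + t * (K * (norm d)\<^sup>2)"
    unfolding eventually_at_filter
  proof (intro always_eventually allI impI)
    fix t :: real
    assume "t \<in> {0<..}"
    then show "0 \<le> (f (x + t *\<^sub>R d) - f x) /\<^sub>R t - v \<bullet> d + t * (K * (norm d)\<^sup>2)"
      using min[of "x + t *\<^sub>R d"] by (simp add: field_simps power2_eq_square)
  qed
  ultimately have "0 \<le> l - v \<bullet> d"
    using tendsto_lowerbound by fastforce
  then show "\<exists>l. has_dir_deriv (\<lambda>z. f z - q z) x d l \<and> 0 \<le> l"
    using has_dir_deriv_diff[OF l GDERIV_imp_has_dir_deriv[OF assms(2)]] by blast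
qed

section \<open>One step of the algorithm\<close>

text \<open>Cauchy--Schwarz and the error criterion bound the perturbation \<open>\<langle>\<delta>, \<beta>' - \<beta>\<rangle>\<close> by
  \<open>\<sigma>/4 \<parallel>\<beta>' - \<beta>\<parallel>\<^sup>2 + \<tau>/2 \<parallel>X \<beta>' - X \<beta>\<parallel>\<^sup>2\<close>, while the model exceeds \<open>g\<close> at \<open>\<beta>'\<close> by at least
  \<open>\<sigma>/2 \<parallel>\<beta>' - \<beta>\<parallel>\<^sup>2 + \<tau>/2 \<parallel>X \<beta>' - X \<beta>\<parallel>\<^sup>2\<close>. The choice \<open>z = \<beta>\<close> gives the descent of \<open>g\<close>; a general
  \<open>z\<close> gives a form of optimality of \<open>\<beta>'\<close> that involves \<open>\<beta>'\<close> only through \<open>g \<beta>'\<close> and the step length.\<close>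
lemma pmm_step2_sufficient_decrease:
  assumes "pmm_step2 X b lam p q gq \<sigma> \<tau> \<beta> \<beta>' u' \<delta>"
    and "convex_on UNIV q" and "GDERIV q \<beta> :> gq \<beta>"
  shows "g_obj X b lam p q \<beta>' + \<sigma> / 4 * (norm (\<beta>' - \<beta>))\<^sup>2
    \<le> h_obj X b lam p q z \<sigma> \<tau> \<beta> (gq \<beta>) (X *v \<beta>) + \<delta> \<bullet> (z - \<beta>)"
proof -
  define D where "D = norm (\<beta>' - \<beta>)"
  define E where "E = norm (X *v \<beta>' - X *v \<beta>)"
  have \<delta>: "norm \<delta> \<le> \<sigma> / 4 * D + \<tau> * E\<^sup>2 / (2 * D)"
    using assms(1) unfolding pmm_step2_def D_def E_def by blast
  have "\<bar>\<delta> \<bullet> (\<beta>' - \<beta>)\<bar> \<le> norm \<delta> * D"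
    unfolding D_def by (rule Cauchy_Schwarz_ineq2)
  also have "\<dots> \<le> (\<sigma> / 4 * D + \<tau> * E\<^sup>2 / (2 * D)) * D"
    by (rule mult_right_mono[OF \<delta>]) (simp add: D_def)
  \<comment> \<open>If the step is zero then so is \<open>E\<close>, and the fraction is \<open>0\<close> by convention.\<close>
  also have "\<dots> = \<sigma> / 4 * D\<^sup>2 + \<tau> / 2 * E\<^sup>2"
    by (cases "\<beta>' = \<beta>") (simp_all add: D_def E_def field_simps power2_eq_square)
  finally have "- (\<sigma> / 4 * D\<^sup>2 + \<tau> / 2 * E\<^sup>2) \<le> \<delta> \<bullet> (\<beta>' - \<beta>)"
    by linarith
  then have "g_obj X b lam p q \<beta>' + \<sigma> / 4 * D\<^sup>2
      \<le> h_obj X b lam p q \<beta>' \<sigma> \<tau> \<beta> (gq \<beta>) (X *v \<beta>) + \<delta> \<bullet> (\<beta>' - \<beta>)"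
    using convex_on_above_gradient[OF assms(2,3), of \<beta>']
    by (simp add: g_obj_def h_obj_def D_def E_def)
  also have "\<dots> \<le> h_obj X b lam p q z \<sigma> \<tau> \<beta> (gq \<beta>) (X *v \<beta>) + \<delta> \<bullet> (z - \<beta>)"
    using assms(1) by (auto simp: pmm_step2_def is_arg_min_def not_less)
  finally show ?thesis
    by (simp add: D_def)
qed

text \<open>With \<open>\<tau>\<close> proportional to \<open>\<sigma>\<close>, the error is controlled by \<open>\<sigma> \<parallel>\<beta>' - \<beta>\<parallel>\<close> rather than by
  \<open>\<parallel>\<beta>' - \<beta>\<parallel>\<close> alone. The factor \<open>\<sigma>\<close> matters when \<open>\<sigma>\<close> tends to \<open>0\<close> along the iteration.\<close>
lemma pmm_step2_error_bound:
  fixes X :: "real^'n^'m"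
  assumes "pmm_step2 X b lam p q gq \<sigma> (c * \<sigma>) \<beta> \<beta>' u' \<delta>" and "0 \<le> c" and "0 < \<sigma>"
  shows "norm \<delta> \<le> (1 / 4 + c * (onorm ((*v) X))\<^sup>2 / 2) * (\<sigma> * norm (\<beta>' - \<beta>))"
proof -
  define D where "D = norm (\<beta>' - \<beta>)"
  define B where "B = onorm ((*v) X)"
  have "norm (X *v \<beta>' - X *v \<beta>) \<le> B * D"
    using onorm[OF matrix_vector_mul_bounded_linear, of X "\<beta>' - \<beta>"]
    by (simp add: B_def D_def matrix_vector_mult_diff_distrib)
  then have "c * \<sigma> * (norm (X *v \<beta>' - X *v \<beta>))\<^sup>2 \<le> c * \<sigma> * (B * D)\<^sup>2"
    using assms by (intro mult_left_mono power_mono) auto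
  then have "c * \<sigma> * (norm (X *v \<beta>' - X *v \<beta>))\<^sup>2 / (2 * D) \<le> c * \<sigma> * (B * D)\<^sup>2 / (2 * D)"
    by (intro divide_right_mono) (auto simp: D_def)
  also have "\<dots> = c * B\<^sup>2 / 2 * (\<sigma> * D)"
    by (simp add: field_simps power2_eq_square)
  finally have "c * \<sigma> * (norm (X *v \<beta>' - X *v \<beta>))\<^sup>2 / (2 * D) \<le> c * B\<^sup>2 / 2 * (\<sigma> * D)" .
  moreover have "norm \<delta> \<le> \<sigma> / 4 * D + c * \<sigma> * (norm (X *v \<beta>' - X *v \<beta>))\<^sup>2 / (2 * D)"
    using assms(1) unfolding pmm_step2_def D_def by blast
  ultimately have "norm \<delta> \<le> (1 / 4 + c * B\<^sup>2 / 2) * (\<sigma> * D)"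
    by (simp add: algebra_simps)
  then show ?thesis
    by (simp add: D_def B_def)
qed

lemma pmm_sequence_parameters:
  assumes "pmm_sequence X b lam p q gq crit \<sigma>1 \<tau>1 \<sigma>2 \<tau>2 \<rho> \<beta> u \<delta>"
  shows "0 < \<sigma>2 k" and "\<tau>2 k = \<tau>2 0 / \<sigma>2 0 * \<sigma>2 k"
proof -
  have "0 < \<sigma>2 k \<and> \<tau>2 k = \<tau>2 0 / \<sigma>2 0 * \<sigma>2 k"
    by (induction k) (use assms in \<open>auto simp: pmm_sequence_def\<close>)
  then show "0 < \<sigma>2 k" and "\<tau>2 k = \<tau>2 0 / \<sigma>2 0 * \<sigma>2 k"
    by auto
qed

section \<open>Cluster points\<close>

theorem theorem4p3:
  fixes X :: "real^'n^'m" and b \<epsilon> :: "real^'m" and \<beta>t :: "real^'n" and lam :: real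
    and p q :: "real^'n \<Rightarrow> real" and gq :: "real^'n \<Rightarrow> real^'n"
    and crit :: "real^'n \<Rightarrow> real^'m \<Rightarrow> (real^'n) \<times> (real^'m) \<Rightarrow> bool"
    and \<sigma>1 \<tau>1 :: real and \<sigma>2 \<tau>2 \<rho> :: "nat \<Rightarrow> real"
    and \<beta> \<delta> :: "nat \<Rightarrow> real^'n" and u :: "nat \<Rightarrow> real^'m"
  assumes "b = X *v \<beta>t + \<epsilon>" and "\<epsilon> \<noteq> 0" and "lam > 0"
    and "is_norm p" and "strongly_semismooth (prox p)"
    and "convex_on UNIV q" and "\<And>x. GDERIV q x :> gq x" and "continuous_on UNIV gq"
    and "bdd_below (range (g_obj X b lam p q))"
    and "non_overfitting X b lam p \<beta>t \<epsilon> \<sigma>1 \<tau>1"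
    and "pmm_sequence X b lam p q gq crit \<sigma>1 \<tau>1 \<sigma>2 \<tau>2 \<rho> \<beta> u \<delta>"
    and "convergent \<sigma>2" and "convergent \<tau>2"
  shows "\<forall>x. cluster_point \<beta> x \<longrightarrow> d_stationary (g_obj X b lam p q) x"
proof (intro allI impI)
  fix x
  assume "cluster_point \<beta> x"
  then obtain r where r: "strict_mono r" and "(\<beta> \<circ> r) \<longlonglongrightarrow> x"
    by (auto simp: cluster_point_def)
  then have \<beta>r: "(\<lambda>j. \<beta> (r j)) \<longlonglongrightarrow> x"
    by (simp add: o_def)
  define f where "f z = norm (X *v z - b) + lam * p z" for z
  define g where "g = g_obj X b lam p q"
  have g: "g = (\<lambda>z. f z - q z)"
    by (simp add: g_def f_def g_obj_def fun_eq_iff)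
  have f_convex: "convex_on UNIV f"
  proof -
    have "convex_on UNIV (\<lambda>z. norm (X *v z - b))"
    proof (rule convex_onI)
      fix t :: real and y z :: "real^'n"
      assume t: "0 < t" "t < 1"
      have "X *v ((1 - t) *\<^sub>R y + t *\<^sub>R z) - b = (1 - t) *\<^sub>R (X *v y - b) + t *\<^sub>R (X *v z - b)"
        by (simp add: matrix_vector_right_distrib matrix_vector_mult_scaleR algebra_simps)
      then show "norm (X *v ((1 - t) *\<^sub>R y + t *\<^sub>R z) - b)
          \<le> (1 - t) * norm (X *v y - b) + t * norm (X *v z - b)"
        using norm_triangle_ineq[of "(1 - t) *\<^sub>R (X *v y - b)" "t *\<^sub>R (X *v z - b)"] t by simp
    qed simp
    moreover have "convex_on UNIV (\<lambda>z. lam * p z)"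
      using assms is_norm_imp_convex_on by (intro convex_on_cmul) auto
    ultimately show ?thesis
      unfolding f_def by (rule convex_on_add)
  qed
  have q_cont: "isCont q y" for y
    using assms(7)[of y] by (simp add: gderiv_def has_derivative_continuous)
  have f_cont: "isCont f y" for y
    using convex_on_continuous[OF open_UNIV f_convex] by (simp add: continuous_on_eq_continuous_at)
  have step: "pmm_step2 X b lam p q gq (\<sigma>2 k) (\<tau>2 k) (\<beta> k) (\<beta> (Suc k)) (u (Suc k)) (\<delta> k)" for k
    using assms(11) by (simp add: pmm_sequence_def)
  define c where "c = \<tau>2 0 / \<sigma>2 0"
  have \<sigma>_pos: "0 < \<sigma>2 k" and \<tau>: "\<tau>2 k = c * \<sigma>2 k" for k
    using pmm_sequence_parameters[OF assms(11), of k] by (simp_all add: c_def)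
  have c: "0 \<le> c"
    using assms(11) by (simp add: pmm_sequence_def c_def)
  obtain \<sigma> \<tau>' where \<sigma>: "\<sigma>2 \<longlonglongrightarrow> \<sigma>" and \<tau>': "\<tau>2 \<longlonglongrightarrow> \<tau>'"
    using assms(12,13) by (auto simp: convergent_def)
  define D where "D k = norm (\<beta> (Suc k) - \<beta> k)" for k
  have decrease: "g (\<beta> (Suc k)) + \<sigma>2 k / 4 * (D k)\<^sup>2
      \<le> h_obj X b lam p q z (\<sigma>2 k) (\<tau>2 k) (\<beta> k) (gq (\<beta> k)) (X *v \<beta> k) + \<delta> k \<bullet> (z - \<beta> k)" for k z
    unfolding g_def D_def by (rule pmm_step2_sufficient_decrease[OF step assms(6,7)])
  have descent: "g (\<beta> (Suc k)) + \<sigma>2 k / 4 * (D k)\<^sup>2 \<le> g (\<beta> k)" for k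
    using decrease[of k "\<beta> k"] by (simp add: h_obj_def g_def g_obj_def)
  have "decseq (\<lambda>k. g (\<beta> k))"
  proof (rule decseq_SucI)
    show "g (\<beta> (Suc k)) \<le> g (\<beta> k)" for k
      using descent[of k] \<sigma>_pos[of k] by (smt (verit) zero_le_power2 mult_nonneg_nonneg divide_nonneg_pos)
  qed
  moreover obtain m where "m \<le> g (\<beta> k)" for k
    using assms(9) by (auto simp: bdd_below_def g_def)
  ultimately obtain L where L: "(\<lambda>k. g (\<beta> k)) \<longlonglongrightarrow> L"
    using decseq_convergent by metis
  \<comment> \<open>The monotone values have one limit, and the subsequence identifies it as \<open>g x\<close>; this also gives
    the limit of the values at the successors \<open>\<beta> (Suc (r j))\<close>, which need not approach \<open>x\<close>.\<close>
  have "(\<lambda>j. g (\<beta> (r j))) \<longlonglongrightarrow> g x"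
    unfolding g by (intro tendsto_diff isCont_tendsto_compose[OF _ \<beta>r] f_cont q_cont)
  then have "L = g x"
    using LIMSEQ_unique[OF LIMSEQ_subseq_LIMSEQ[OF L r]] by (simp add: o_def)
  then have gS: "(\<lambda>k. g (\<beta> (Suc k))) \<longlonglongrightarrow> g x"
    using LIMSEQ_Suc[OF L] by simp
  have "(\<lambda>k. 4 * (g (\<beta> k) - g (\<beta> (Suc k)))) \<longlonglongrightarrow> 4 * (L - g x)"
    by (intro tendsto_intros L gS)
  then have "(\<lambda>k. 4 * (g (\<beta> k) - g (\<beta> (Suc k)))) \<longlonglongrightarrow> 0"
    by (simp add: \<open>L = g x\<close>)
  then have "(\<lambda>k. \<sigma>2 k * (D k)\<^sup>2) \<longlonglongrightarrow> 0"
  proof (rule tendsto_sandwich[rotated 3])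
    show "\<forall>\<^sub>F k in sequentially. 0 \<le> \<sigma>2 k * (D k)\<^sup>2"
      using \<sigma>_pos by (simp add: less_imp_le)
    show "\<forall>\<^sub>F k in sequentially. \<sigma>2 k * (D k)\<^sup>2 \<le> 4 * (g (\<beta> k) - g (\<beta> (Suc k)))"
    proof (intro always_eventually allI)
      show "\<sigma>2 k * (D k)\<^sup>2 \<le> 4 * (g (\<beta> k) - g (\<beta> (Suc k)))" for k
        using descent[of k] by (simp add: field_simps)
    qed
  qed simp
  \<comment> \<open>One more factor \<open>\<sigma>2 k\<close>, which is bounded, makes this a square. It yields
    \<open>\<sigma>2 k * D k \<longlonglongrightarrow> 0\<close> even when \<open>\<sigma> = 0\<close> and \<open>D k\<close> does not tend to \<open>0\<close>.\<close>
  from tendsto_mult[OF \<sigma> this] have "(\<lambda>k. (\<sigma>2 k * D k)\<^sup>2) \<longlonglongrightarrow> 0"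
    by (simp add: power2_eq_square mult_ac)
  then have "(\<lambda>k. \<sigma>2 k * D k) \<longlonglongrightarrow> 0"
    using tendsto_power_zero by (simp add: tendsto_null_power)
  then have "(\<lambda>k. (1 / 4 + c * (onorm ((*v) X))\<^sup>2 / 2) * (\<sigma>2 k * D k)) \<longlonglongrightarrow> 0"
    by (rule tendsto_mult_right_zero)
  then have "\<delta> \<longlonglongrightarrow> 0"
    by (rule Lim_null_comparison[rotated])
      (use pmm_step2_error_bound[OF step[unfolded \<tau>] c \<sigma>_pos] in \<open>simp add: D_def\<close>)
  then have \<delta>r: "(\<lambda>j. \<delta> (r j)) \<longlonglongrightarrow> 0"
    using LIMSEQ_subseq_LIMSEQ[OF _ r] by (force simp: o_def)
  have \<sigma>r: "(\<lambda>j. \<sigma>2 (r j)) \<longlonglongrightarrow> \<sigma>" and \<tau>r: "(\<lambda>j. \<tau>2 (r j)) \<longlonglongrightarrow> \<tau>'"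
    and gSr: "(\<lambda>j. g (\<beta> (Suc (r j)))) \<longlonglongrightarrow> g x"
    using LIMSEQ_subseq_LIMSEQ[OF _ r] \<sigma> \<tau>' gS by (force simp: o_def)+
  have gqr: "(\<lambda>j. gq (\<beta> (r j))) \<longlonglongrightarrow> gq x"
    using assms(8) \<beta>r by (auto simp: continuous_on_eq_continuous_at intro: isCont_tendsto_compose)
  have majorant: "g x \<le> f z - q x - gq x \<bullet> (z - x)
      + \<sigma> / 2 * (norm (z - x))\<^sup>2 + \<tau>' / 2 * (norm (X *v z - X *v x))\<^sup>2" for z
  proof (rule LIMSEQ_le[OF gSr])
    have "(\<lambda>j. f z - q (\<beta> (r j)) - gq (\<beta> (r j)) \<bullet> (z - \<beta> (r j))
        + \<sigma>2 (r j) / 2 * (norm (z - \<beta> (r j)))\<^sup>2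
        + \<tau>2 (r j) / 2 * (norm (X *v z - X *v \<beta> (r j)))\<^sup>2 + \<delta> (r j) \<bullet> (z - \<beta> (r j)))
      \<longlonglongrightarrow> f z - q x - gq x \<bullet> (z - x)
        + \<sigma> / 2 * (norm (z - x))\<^sup>2 + \<tau>' / 2 * (norm (X *v z - X *v x))\<^sup>2 + 0 \<bullet> (z - x)"
      by (intro tendsto_intros isCont_tendsto_compose[OF q_cont \<beta>r] gqr \<sigma>r \<tau>r \<delta>r \<beta>r
          bounded_linear.tendsto[OF matrix_vector_mul_bounded_linear]) auto
    then show "(\<lambda>j. h_obj X b lam p q z (\<sigma>2 (r j)) (\<tau>2 (r j)) (\<beta> (r j)) (gq (\<beta> (r j)))
          (X *v \<beta> (r j)) + \<delta> (r j) \<bullet> (z - \<beta> (r j)))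
      \<longlonglongrightarrow> f z - q x - gq x \<bullet> (z - x)
        + \<sigma> / 2 * (norm (z - x))\<^sup>2 + \<tau>' / 2 * (norm (X *v z - X *v x))\<^sup>2"
      by (simp add: h_obj_def f_def)
    show "\<exists>N. \<forall>j\<ge>N. g (\<beta> (Suc (r j)))
      \<le> h_obj X b lam p q z (\<sigma>2 (r j)) (\<tau>2 (r j)) (\<beta> (r j)) (gq (\<beta> (r j)))
          (X *v \<beta> (r j)) + \<delta> (r j) \<bullet> (z - \<beta> (r j))"
    proof (intro exI allI impI)
      fix j
      have "0 \<le> \<sigma>2 (r j) / 4 * (D (r j))\<^sup>2"
        using \<sigma>_pos[of "r j"] by simp
      then show "g (\<beta> (Suc (r j)))
        \<le> h_obj X b lam p q z (\<sigma>2 (r j)) (\<tau>2 (r j)) (\<beta> (r j)) (gq (\<beta> (r j)))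
            (X *v \<beta> (r j)) + \<delta> (r j) \<bullet> (z - \<beta> (r j))"
        using decrease[of "r j" z] by linarith
    qed
  qed
  have \<tau>'_nonneg: "0 \<le> \<tau>'"
    using \<tau>' by (rule LIMSEQ_le_const) (use \<tau> c \<sigma>_pos in \<open>auto simp: less_imp_le\<close>)
  have "d_stationary (\<lambda>z. f z - q z) x"
  proof (rule d_stationary_of_quadratic_majorant[OF f_convex assms(7)])
    fix z
    have "norm (X *v z - X *v x) \<le> onorm ((*v) X) * norm (z - x)"
      using onorm[OF matrix_vector_mul_bounded_linear, of X "z - x"]
      by (simp add: matrix_vector_mult_diff_distrib)
    then have "\<tau>' / 2 * (norm (X *v z - X *v x))\<^sup>2
        \<le> \<tau>' / 2 * (onorm ((*v) X) * norm (z - x))\<^sup>2"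
      using \<tau>'_nonneg by (intro mult_left_mono power_mono) auto
    then show "f x \<le> f z - gq x \<bullet> (z - x)
        + (\<sigma> / 2 + \<tau>' / 2 * (onorm ((*v) X))\<^sup>2) * (norm (z - x))\<^sup>2"
      using majorant[of z] by (simp add: g power_mult_distrib algebra_simps)
  qed
  then show "d_stationary (g_obj X b lam p q) x"
    using g by (simp add: g_def)
qed

end
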